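(* Let $P$ be an irreducible stochastic matrix on a finite set $\mathcal V$, and let $\pi=\pi P$ be its invariant probability vector. Then, for all $\mathcal W\subseteq\mathcal V$, the entrance time $\tau^*_{\mathcal W}$ satisfies $$\tau^*_{\mathcal W}\ge\lambda_{\mathcal W}\left(\frac1{\pi(\mathcal W)}-1\right).$$
   Context: A stochastic matrix is a nonnegative square matrix with all row sums equal to $1$; it is irreducible if the directed graph on $\mathcal V$ with a link $(u,v)$ whenever $P_{uv}>0$ is strongly connected. $\pi(\mathcal W):=\sum_{w\in\mathcal W}\pi_w$. Entrance time: the numbers $\tau^u_{\mathcal W}$, $u\in\mathcal V$, are the solution of $\tau^u_{\mathcal W}=0$ for $u\in\mathcal W$ and $\tau^u_{\mathcal W}=1+\sum_{v\in\mathcal V}P_{uv}\tau^v_{\mathcal W}$ for $u\in\mathcal V\setminus\mathcal W$; equivalently, $\tau^u_{\mathcal W}$ is the expected hitting time of $\mathcal W$ for a Markov chain with transition matrix $P$ started at $u$. Then $\tau^*_{\mathcal W}:=\min_{u\in\mathcal V\setminus\mathcal W}\tau^u_{\mathcal W}$. External boundaries of $\mathcal W$: $$\partial^+_{\mathcal W}:=\{v\in\mathcal V\setminus\mathcal W: P_{wv}>0\text{ for some }w\in\mathcal W\},\qquad \partial^-_{\mathcal W}:=\{v\in\mathcal V\setminus\mathcal W: P_{vw}>0\text{ for some }w\in\mathcal W\}.$$ For $u\in\partial^-_{\mathcal W}$ and $v\in\partial^+_{\mathcal W}$, let $\Gamma_{u,v}$ be the (possibly empty) set of simple paths in $\mathcal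 V\setminus\mathcal W$ starting in $u$ and ending in $v$ (paths in the graph of $P$, i.e. consecutive nodes $x,y$ satisfy $P_{xy}>0$, all nodes lying in $\mathcal V\setminus\mathcal W$). For a path $\xi=(u=\xi_0,\xi_1,\ldots,\xi_l=v)\in\Gamma_{u,v}$ let $P_\xi:=\prod_{1\le i\le l}P_{\xi_{i-1}\xi_i}$. Define $$\lambda_{\mathcal W}:=\min_{u,v}\ \max_{\xi\in\Gamma_{u,v}}P_\xi,$$ where the minimum runs over all $u\in\partial^-_{\mathcal W}$ and $v\in\partial^+_{\mathcal W}$ with $u\ne v$, and, in this definition, the minimum over an empty set equals $1$ and the maximum over an empty set equals $0$. Conventions for degenerate cases: if $\mathcal W=\emptyset$ or $\mathcal W=\mathcal V$ then $\tau^*_{\mathcal W}=+\infty$, and $1/0=+\infty$. *)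

theory Defs
  imports "HOL-Analysis.Analysis"
begin

definition stochastic :: "real^'v^'v \<Rightarrow> bool" where
  "stochastic P \<longleftrightarrow> (\<forall>u v. P $ u $ v \<ge> 0) \<and> (\<forall>u. (\<Sum>v\<in>UNIV. P $ u $ v) = 1)"

definition links :: "real^'v^'v \<Rightarrow> ('v \<times> 'v) set" where
  "links P = {(u, v). P $ u $ v > 0}"

definition irreducible_matrix :: "real^'v^'v \<Rightarrow> bool" where
  "irreducible_matrix P \<longleftrightarrow> (\<forall>u v. (u, v) \<in> (links P)\<^sup>*)"

definition probability_vector :: "real^'v \<Rightarrow> bool" where
  "probability_vector \<pi> \<longleftrightarrow> (\<forall>v. \<pi> $ v \<ge> 0) \<and> (\<Sum>v\<in>UNIV. \<pi> $ v) = 1"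

definition mass :: "real^'v \<Rightarrow> 'v set \<Rightarrow> real" where
  "mass \<pi> W = (\<Sum>w\<in>W. \<pi> $ w)"

(* For irreducible stochastic P the system has exactly one solution when W is nonempty and
   none when W is empty; in the latter case the value is unspecified. *)
definition entrance_times :: "real^'v^'v \<Rightarrow> 'v set \<Rightarrow> real^'v" where
  "entrance_times P W =
     (THE \<tau>. (\<forall>u\<in>W. \<tau> $ u = 0) \<and>
             (\<forall>u\<in>UNIV - W. \<tau> $ u = 1 + (\<Sum>v\<in>UNIV. P $ u $ v * \<tau> $ v)))"

definition min_entrance_time :: "real^'v^'v \<Rightarrow> 'v set \<Rightarrow> ereal" where
  "min_entrance_time P W =
     (if W = {} \<or> W = UNIV then \<infinity>
      else ereal (Min ((\<lambda>u. entrance_times P W $ u) ` (UNIV - W))))"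

definition out_boundary :: "real^'v^'v \<Rightarrow> 'v set \<Rightarrow> 'v set" where
  "out_boundary P W = {v \<in> UNIV - W. \<exists>w\<in>W. (w, v) \<in> links P}"

definition in_boundary :: "real^'v^'v \<Rightarrow> 'v set \<Rightarrow> 'v set" where
  "in_boundary P W = {v \<in> UNIV - W. \<exists>w\<in>W. (v, w) \<in> links P}"

(* A path is represented by its nonempty list of nodes. *)
definition simple_paths_avoiding :: "real^'v^'v \<Rightarrow> 'v set \<Rightarrow> 'v \<Rightarrow> 'v \<Rightarrow> 'v list set" where
  "simple_paths_avoiding P W u v =
     {\<xi>. \<xi> \<noteq> [] \<and> hd \<xi> = u \<and> last \<xi> = v \<and> distinct \<xi> \<and> set \<xi> \<subseteq> UNIV - W \<and>
         successively (\<lambda>x y. (x, y) \<in> links P) \<xi>}"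

definition path_weight :: "real^'v^'v \<Rightarrow> 'v list \<Rightarrow> real" where
  "path_weight P \<xi> = (\<Prod>i\<in>{1..<length \<xi>}. P $ (\<xi> ! (i - 1)) $ (\<xi> ! i))"

definition max_path_weight :: "real^'v^'v \<Rightarrow> 'v set \<Rightarrow> 'v \<Rightarrow> 'v \<Rightarrow> real" where
  "max_path_weight P W u v =
     (if simple_paths_avoiding P W u v = {} then 0
      else Max (path_weight P ` simple_paths_avoiding P W u v))"

definition boundary_pairs :: "real^'v^'v \<Rightarrow> 'v set \<Rightarrow> ('v \<times> 'v) set" where
  "boundary_pairs P W = {(u, v). u \<in> in_boundary P W \<and> v \<in> out_boundary P W \<and> u \<noteq> v}"

definition path_conductance :: "real^'v^'v \<Rightarrow> 'v set \<Rightarrow> real" where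
  "path_conductance P W =
     (if boundary_pairs P W = {} then 1
      else Min ((\<lambda>(u, v). max_path_weight P W u v) ` boundary_pairs P W))"

end

(* Let tau be the vector of entrance times of W. It is nonnegative, so tau_x >= P_xy tau_y for
   x outside W, and iterating along a path gives tau_u >= P_xi tau_v. A minimizer u of tau
   outside W has a link into W, since otherwise tau_u = 1 + (P tau)_u > tau_u; hence
   lambda tau_v <= tau_u for every v in the outer boundary. Averaging tau against pi gives Kac's
   identity: the sum over w in W of pi_w (P tau)_w equals 1 - pi(W). Only v in W (where tau
   vanishes) and v in the outer boundary contribute to its left-hand side, so
   lambda (1 - pi(W)) <= pi(W) tau_u. *)
theory Submission
  imports Defs
begin

section \<open>Entrance times\<close>

lemma stochastic_le_1:
  assumes "stochastic P"
  shows "P $ u $ v \<le> 1"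
proof -
  have "P $ u $ v \<le> (\<Sum>v\<in>UNIV. P $ u $ v)"
    using assms by (intro member_le_sum) (auto simp: stochastic_def)
  then show ?thesis using assms by (simp add: stochastic_def)
qed

text \<open>The sum is an average of \<open>h\<close> over the successors of \<open>u\<close>. The
  bound is asked for at successors only, because for a minimizer of the entrance times it is known
  only off \<open>W\<close>.\<close>

lemma stochastic_sum_ge:
  fixes h :: "real^'v"
  assumes "stochastic P" and "\<And>v. P $ u $ v > 0 \<Longrightarrow> c \<le> h $ v"
  shows "c \<le> (\<Sum>v\<in>UNIV. P $ u $ v * h $ v)"
proof -
  have "c = (\<Sum>v\<in>UNIV. P $ u $ v * c)"
    using assms(1) by (simp add: stochastic_def flip: sum_distrib_right)
  also have "\<dots> \<le> (\<Sum>v\<in>UNIV. P $ u $ v * h $ v)"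
  proof (rule sum_mono)
    fix v
    have "P $ u $ v \<ge> 0" using assms(1) by (simp add: stochastic_def)
    then show "P $ u $ v * c \<le> P $ u $ v * h $ v"
      using assms(2)[of v] by (cases "P $ u $ v = 0") (auto intro: mult_left_mono)
  qed
  finally show ?thesis .
qed

text \<open>Minimum principle: a negative minimum is attained off \<open>W\<close>, harmonicity
  passes it on to all successors, and irreducibility carries it into \<open>W\<close>, where
  \<open>h\<close> vanishes.\<close>

lemma harmonic_off_nonneg:
  fixes P :: "real^'v^'v" and h :: "real^'v"
  assumes P: "stochastic P" "irreducible_matrix P" and W: "W \<noteq> {}"
    and zero: "\<And>u. u \<in> W \<Longrightarrow> h $ u = 0"
    and harm: "\<And>u. u \<notin> W \<Longrightarrow> h $ u = (\<Sum>v\<in>UNIV. P $ u $ v * h $ v)"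
  shows "0 \<le> h $ x"
proof (rule ccontr)
  assume neg: "\<not> 0 \<le> h $ x"
  define m where "m = Min (range (\<lambda>u. h $ u))"
  have m_le: "m \<le> h $ u" for u unfolding m_def by simp
  have "m \<in> range (\<lambda>u. h $ u)" unfolding m_def by (intro Min_in) auto
  then obtain a where a: "h $ a = m" by auto
  have "m < 0" using neg m_le[of x] by simp
  from W obtain w where w: "w \<in> W" by auto
  have "(a, w) \<in> (links P)\<^sup>*" using P(2) by (simp add: irreducible_matrix_def)
  then have "h $ w = m"
  proof induction
    case base
    then show ?case by (rule a)
  next
    case (step y z)
    then have "y \<notin> W" using zero \<open>m < 0\<close> by force
    have pos: "P $ y $ z > 0" using step(2) by (simp add: links_def)
    \<comment> \<open>A vanishing sum of nonnegative terms: every successor of \<open>y\<close> must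
      attain the minimum \<open>m\<close> as well.\<close>
    have "(\<Sum>v\<in>UNIV. P $ y $ v * (h $ v - m)) = 0"
      using harm[OF \<open>y \<notin> W\<close>] step(3) P(1)
      by (simp add: right_diff_distrib sum_subtractf stochastic_def flip: sum_distrib_right)
    then have "P $ y $ z * (h $ z - m) = 0"
      using P(1) m_le by (subst (asm) sum_nonneg_eq_0_iff) (auto simp: stochastic_def)
    then show ?case using pos by simp
  qed
  then show False using zero[OF w] \<open>m < 0\<close> by simp
qed

text \<open>The minimum principle applies to both \<open>h\<close> and \<open>- h\<close>.\<close>

lemma harmonic_off_eq_0:
  fixes P :: "real^'v^'v" and h :: "real^'v"
  assumes "stochastic P" "irreducible_matrix P" "W \<noteq> {}"
    and zero: "\<And>u. u \<in> W \<Longrightarrow> h $ u = 0"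
    and harm: "\<And>u. u \<notin> W \<Longrightarrow> h $ u = (\<Sum>v\<in>UNIV. P $ u $ v * h $ v)"
  shows "h = 0"
proof -
  have "0 \<le> h $ x" for x
    using harmonic_off_nonneg[OF assms(1-3) zero harm] .
  moreover have "0 \<le> (- h) $ x" for x
  proof (rule harmonic_off_nonneg[OF assms(1-3)])
    show "(- h) $ u = (\<Sum>v\<in>UNIV. P $ u $ v * (- h) $ v)" if "u \<notin> W" for u
      using harm[OF that] by (simp add: sum_negf)
  qed (simp add: zero)
  ultimately show ?thesis by (simp add: vec_eq_iff order_antisym)
qed

text \<open>The system is linear in finitely many unknowns, so existence follows from uniqueness,
  and uniqueness means that the homogeneous system has only the zero solution.\<close>

lemma entrance_times_ex1:
  fixes P :: "real^'v^'v"
  assumes "stochastic P" "irreducible_matrix P" "W \<noteq> {}"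
  shows "\<exists>!\<tau> :: real^'v. (\<forall>u\<in>W. \<tau> $ u = 0) \<and>
    (\<forall>u\<in>UNIV - W. \<tau> $ u = 1 + (\<Sum>v\<in>UNIV. P $ u $ v * \<tau> $ v))"
proof -
  \<comment> \<open>\<open>L\<close> is the identity on \<open>W\<close> and \<open>I - P\<close>
    off \<open>W\<close>; the entrance times are the preimage of the indicator of the complement of
    \<open>W\<close>.\<close>
  define L :: "real^'v \<Rightarrow> real^'v" where
    "L h = (\<chi> u. if u \<in> W then h $ u else h $ u - (\<Sum>v\<in>UNIV. P $ u $ v * h $ v))" for h
  have lin: "linear L"
    by (rule linearI)
       (auto simp: L_def vec_eq_iff algebra_simps sum.distrib sum_distrib_left)
  have inj: "inj L"
    unfolding linear_injective_0[OF lin]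
  proof (intro allI impI)
    fix h assume "L h = 0"
    then have "(if u \<in> W then h $ u else h $ u - (\<Sum>v\<in>UNIV. P $ u $ v * h $ v)) = 0" for u
      by (simp add: L_def vec_eq_iff)
    note * = this
    show "h = 0"
    proof (rule harmonic_off_eq_0[OF assms])
      show "h $ u = 0" if "u \<in> W" for u using *[of u] that by simp
      show "h $ u = (\<Sum>v\<in>UNIV. P $ u $ v * h $ v)" if "u \<notin> W" for u
        using *[of u] that by simp
    qed
  qed
  have "bij L" using linear_injective_imp_surjective[OF lin inj] inj by (simp add: bij_def)
  then have "\<exists>!\<tau>. L \<tau> = (\<chi> u. if u \<in> W then 0 else 1)"
    by (metis bij_pointE)
  moreover have "L \<tau> = (\<chi> u. if u \<in> W then 0 else 1) \<longleftrightarrow> (\<forall>u\<in>W. \<tau> $ u = 0) \<and>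
    (\<forall>u\<in>UNIV - W. \<tau> $ u = 1 + (\<Sum>v\<in>UNIV. P $ u $ v * \<tau> $ v))" for \<tau>
    by (auto simp: L_def vec_eq_iff diff_eq_eq)
  ultimately show ?thesis by simp
qed

lemma
  fixes P :: "real^'v^'v"
  assumes "stochastic P" "irreducible_matrix P" "W \<noteq> {}"
  shows entrance_times_in: "u \<in> W \<Longrightarrow> entrance_times P W $ u = 0"
    and entrance_times_off: "u \<notin> W \<Longrightarrow>
      entrance_times P W $ u = 1 + (\<Sum>v\<in>UNIV. P $ u $ v * entrance_times P W $ v)"
  using theI'[OF entrance_times_ex1[OF assms]] by (auto simp: entrance_times_def)

text \<open>At a global minimizer off \<open>W\<close> the equation would give m \<ge> 1 + m, so the
  minimum is attained in \<open>W\<close> and equals 0.\<close>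

lemma entrance_times_nonneg:
  fixes P :: "real^'v^'v"
  assumes "stochastic P" "irreducible_matrix P" "W \<noteq> {}"
  shows "0 \<le> entrance_times P W $ x"
proof -
  let ?\<tau> = "entrance_times P W"
  define m where "m = Min (range (\<lambda>u. ?\<tau> $ u))"
  have m_le: "m \<le> ?\<tau> $ u" for u unfolding m_def by simp
  have "m \<in> range (\<lambda>u. ?\<tau> $ u)" unfolding m_def by (intro Min_in) auto
  then obtain a where a: "?\<tau> $ a = m" by auto
  have "m \<le> (\<Sum>v\<in>UNIV. P $ a $ v * ?\<tau> $ v)"
    using assms(1) m_le by (intro stochastic_sum_ge) auto
  then have "a \<in> W" using entrance_times_off[OF assms, of a] a by auto
  then show ?thesis using entrance_times_in[OF assms] a m_le[of x] by simp
qed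

lemma entrance_times_minimizer_in_boundary:
  fixes P :: "real^'v^'v"
  assumes P: "stochastic P" "irreducible_matrix P" "W \<noteq> {}"
    and u: "u \<notin> W" and min: "\<And>v. v \<notin> W \<Longrightarrow> entrance_times P W $ u \<le> entrance_times P W $ v"
  shows "u \<in> in_boundary P W"
proof (rule ccontr)
  assume "u \<notin> in_boundary P W"
  then have "v \<notin> W" if "P $ u $ v > 0" for v
    using u that by (auto simp: in_boundary_def links_def)
  then have "entrance_times P W $ u \<le> (\<Sum>v\<in>UNIV. P $ u $ v * entrance_times P W $ v)"
    using min by (intro stochastic_sum_ge P(1)) auto
  then show False using entrance_times_off[OF P u] by simp
qed

text \<open>By invariance, \<open>?\<tau>\<close> and \<open>P\<close> applied to
  \<open>?\<tau>\<close> have the same \<open>\<pi>\<close>-average. They differ by exactly 1 off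
  \<open>W\<close>, and \<open>?\<tau>\<close> vanishes on \<open>W\<close>. The inner sum is the
  expected return time to \<open>W\<close> from \<open>w\<close>, less 1.\<close>

lemma kac_identity:
  fixes P :: "real^'v^'v"
  assumes P: "stochastic P" "irreducible_matrix P" "W \<noteq> {}"
    and pi: "probability_vector \<pi>" "\<pi> v* P = \<pi>"
  shows "(\<Sum>w\<in>W. \<pi> $ w * (\<Sum>v\<in>UNIV. P $ w $ v * entrance_times P W $ v)) = 1 - mass \<pi> W"
proof -
  let ?\<tau> = "entrance_times P W"
  let ?h = "\<lambda>u. \<Sum>v\<in>UNIV. P $ u $ v * ?\<tau> $ v"
  have inv: "(\<Sum>u\<in>UNIV. \<pi> $ u * P $ u $ v) = \<pi> $ v" for v
    using arg_cong[OF pi(2), of "\<lambda>x. x $ v"] by (simp add: vector_matrix_mult_def mult.commute)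
  have "(\<Sum>u\<in>UNIV. \<pi> $ u * ?h u) = (\<Sum>v\<in>UNIV. \<Sum>u\<in>UNIV. \<pi> $ u * P $ u $ v * ?\<tau> $ v)"
    by (subst sum.swap) (simp add: sum_distrib_left mult.assoc)
  also have "\<dots> = (\<Sum>v\<in>UNIV. \<pi> $ v * ?\<tau> $ v)"
    by (simp add: inv flip: sum_distrib_right)
  also have "\<dots> = (\<Sum>v\<in>W. \<pi> $ v * ?\<tau> $ v) + (\<Sum>v\<in>UNIV - W. \<pi> $ v * ?\<tau> $ v)"
    by (simp add: sum.subset_diff[of W UNIV])
  also have "\<dots> = (\<Sum>v\<in>UNIV - W. \<pi> $ v + \<pi> $ v * ?h v)"
    using entrance_times_in[OF P] entrance_times_off[OF P] by (simp add: distrib_left)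
  also have "\<dots> = (\<Sum>v\<in>UNIV - W. \<pi> $ v) + (\<Sum>v\<in>UNIV - W. \<pi> $ v * ?h v)"
    by (rule sum.distrib)
  \<comment> \<open>The average of \<open>?h\<close> is split over \<open>W\<close> and its
    complement; the complement part cancels.\<close>
  finally have "(\<Sum>w\<in>W. \<pi> $ w * ?h w) = (\<Sum>v\<in>UNIV - W. \<pi> $ v)"
    by (simp add: sum.subset_diff[of W UNIV])
  then show ?thesis
    using pi(1) by (simp add: probability_vector_def mass_def sum_diff)
qed

section \<open>Path weights\<close>

lemma path_weight_singleton [simp]: "path_weight P [x] = 1"
  by (simp add: path_weight_def)

lemma path_weight_Cons_Cons [simp]:
  "path_weight P (x # y # \<xi>) = P $ x $ y * path_weight P (y # \<xi>)"
proof -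
  \<comment> \<open>Indices are shifted to start at 0 so that the factor of the first link can be
    split off.\<close>
  have "path_weight P (x # y # \<xi>) =
      (\<Prod>i\<in>{0..<Suc (length \<xi>)}. P $ ((x # y # \<xi>) ! i) $ ((y # \<xi>) ! i))"
    unfolding path_weight_def
    by (rule prod.reindex_bij_witness[of _ Suc "\<lambda>i. i - 1"]) (auto simp: nth_Cons')
  also have "\<dots> = P $ x $ y * (\<Prod>i\<in>{0..<length \<xi>}. P $ ((y # \<xi>) ! i) $ (\<xi> ! i))"
    by (subst prod.atLeast0_lessThan_Suc_shift) simp
  also have "(\<Prod>i\<in>{0..<length \<xi>}. P $ ((y # \<xi>) ! i) $ (\<xi> ! i)) = path_weight P (y # \<xi>)"
    unfolding path_weight_def
    by (rule prod.reindex_bij_witness[of _ "\<lambda>i. i - 1" Suc]) (auto simp: nth_Cons')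
  finally show ?thesis .
qed

lemma path_weight_le_1:
  assumes "stochastic P"
  shows "path_weight P \<xi> \<le> 1"
  unfolding path_weight_def
  using assms stochastic_le_1[OF assms] by (intro prod_le_1) (auto simp: stochastic_def)

lemma path_weight_entrance_times:
  fixes P :: "real^'v^'v"
  assumes P: "stochastic P" "irreducible_matrix P" "W \<noteq> {}"
    and "\<xi> \<noteq> []" "set \<xi> \<subseteq> UNIV - W"
  shows "path_weight P \<xi> * entrance_times P W $ last \<xi> \<le> entrance_times P W $ hd \<xi>"
  using assms(4,5)
proof (induction \<xi> rule: induct_list012)
  case (3 x y \<xi>)
  let ?\<tau> = "entrance_times P W"
  have nonneg: "0 \<le> P $ x $ v" for v using P(1) by (simp add: stochastic_def)
  have "path_weight P (y # \<xi>) * ?\<tau> $ last (y # \<xi>) \<le> ?\<tau> $ y" using 3 by simp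
  then have "path_weight P (x # y # \<xi>) * ?\<tau> $ last (x # y # \<xi>) \<le> P $ x $ y * ?\<tau> $ y"
    using mult_left_mono[OF _ nonneg] by (simp add: mult.assoc)
  \<comment> \<open>One summand is at most the whole sum since all summands are nonnegative.\<close>
  also have "\<dots> \<le> (\<Sum>v\<in>UNIV. P $ x $ v * ?\<tau> $ v)"
    using nonneg entrance_times_nonneg[OF P] by (intro member_le_sum) auto
  also have "\<dots> \<le> ?\<tau> $ x" using entrance_times_off[OF P, of x] 3 by simp
  finally show ?case by simp
qed auto

section \<open>Extremal path weights and the conductance\<close>

lemma finite_simple_paths_avoiding: "finite (simple_paths_avoiding P W u v)"
  by (rule finite_subset[OF _ finite_subset_distinct[of UNIV]])
     (auto simp: simple_paths_avoiding_def)

text \<open>Separates the default value 0, taken when there is no path, from a maximum over a finite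
  nonempty set, which is attained.\<close>

lemma max_path_weight_cases:
  obtains "max_path_weight P W u v = 0"
  | \<xi> where "\<xi> \<in> simple_paths_avoiding P W u v" "max_path_weight P W u v = path_weight P \<xi>"
proof (cases "simple_paths_avoiding P W u v = {}")
  case True
  then show ?thesis using that(1) by (simp add: max_path_weight_def)
next
  case False
  then have "max_path_weight P W u v \<in> path_weight P ` simple_paths_avoiding P W u v"
    using Max_in[of "path_weight P ` simple_paths_avoiding P W u v"]
    by (simp add: max_path_weight_def finite_simple_paths_avoiding)
  then show ?thesis using that(2) by auto
qed

lemma path_conductance_le:
  assumes "(u, v) \<in> boundary_pairs P W"
  shows "path_conductance P W \<le> max_path_weight P W u v"
proof -
  have "finite (boundary_pairs P W)" by simp
  then show ?thesis
    using assms by (auto simp: path_conductance_def intro!: Min_le rev_image_eqI)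
qed

text \<open>Serves the case of equal boundary nodes, which \<open>boundary_pairs\<close> excludes.
  The default value 1 of the empty minimum is just small enough.\<close>

lemma path_conductance_le_1:
  assumes "stochastic P"
  shows "path_conductance P W \<le> 1"
proof (cases "boundary_pairs P W = {}")
  case False
  then obtain u v where "(u, v) \<in> boundary_pairs P W" by auto
  then have "path_conductance P W \<le> max_path_weight P W u v" by (rule path_conductance_le)
  also have "\<dots> \<le> 1"
    by (rule max_path_weight_cases[of P W u v]) (auto simp: path_weight_le_1[OF assms])
  finally show ?thesis .
qed (simp add: path_conductance_def)

lemma path_conductance_entrance_times:
  fixes P :: "real^'v^'v"
  assumes P: "stochastic P" "irreducible_matrix P" "W \<noteq> {}"
    and uv: "u \<in> in_boundary P W" "v \<in> out_boundary P W"
  shows "path_conductance P W * entrance_times P W $ v \<le> entrance_times P W $ u"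
proof (cases "u = v")
  case True
  then show ?thesis
    using mult_right_mono[OF path_conductance_le_1[OF P(1)] entrance_times_nonneg[OF P]] by simp
next
  case False
  then have "path_conductance P W \<le> max_path_weight P W u v"
    using uv by (intro path_conductance_le) (simp add: boundary_pairs_def)
  then have "path_conductance P W * entrance_times P W $ v
      \<le> max_path_weight P W u v * entrance_times P W $ v"
    using entrance_times_nonneg[OF P] by (rule mult_right_mono)
  also have "\<dots> \<le> entrance_times P W $ u"
  proof (rule max_path_weight_cases[of P W u v])
    fix \<xi> assume "\<xi> \<in> simple_paths_avoiding P W u v"
      and "max_path_weight P W u v = path_weight P \<xi>"
    then show ?thesis
      using path_weight_entrance_times[OF P, of \<xi>] by (auto simp: simple_paths_avoiding_def)
  qed (simp add: entrance_times_nonneg[OF P])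
  finally show ?thesis .
qed

section \<open>The inequality at a minimizer and its transfer to \<open>ereal\<close>\<close>

lemma entrance_times_minimizer_bound:
  fixes P :: "real^'v^'v"
  assumes P: "stochastic P" "irreducible_matrix P" "W \<noteq> {}"
    and pi: "probability_vector \<pi>" "\<pi> v* P = \<pi>"
    and u: "u \<notin> W" and min: "\<And>v. v \<notin> W \<Longrightarrow> entrance_times P W $ u \<le> entrance_times P W $ v"
  shows "path_conductance P W * (1 - mass \<pi> W) \<le> mass \<pi> W * entrance_times P W $ u"
proof -
  let ?\<tau> = "entrance_times P W" and ?c = "path_conductance P W"
  have u_in: "u \<in> in_boundary P W"
    using P u min by (rule entrance_times_minimizer_in_boundary)
  have bound: "?c * (P $ w $ v * ?\<tau> $ v) \<le> P $ w $ v * ?\<tau> $ u" if w: "w \<in> W" for w v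
  proof -
    have nonneg: "0 \<le> P $ w $ v" using P(1) by (simp add: stochastic_def)
    \<comment> \<open>In the first case \<open>?\<tau>\<close> vanishes at \<open>v\<close>, in the
      second the weight is 0; only the third uses the path estimate.\<close>
    consider "v \<in> W" | "v \<notin> W" "P $ w $ v = 0" | "v \<in> out_boundary P W"
      using w nonneg by (force simp: out_boundary_def links_def)
    then show ?thesis
    proof cases
      case 1
      then show ?thesis
        using entrance_times_in[OF P] entrance_times_nonneg[OF P, of u] nonneg by simp
    next
      case 3
      then show ?thesis
        using mult_left_mono[OF path_conductance_entrance_times[OF P u_in] nonneg]
        by (simp add: mult.left_commute)
    qed simp
  qed
  have "?c * (1 - mass \<pi> W) = (\<Sum>w\<in>W. \<pi> $ w * (\<Sum>v\<in>UNIV. ?c * (P $ w $ v * ?\<tau> $ v)))"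
    unfolding kac_identity[OF P pi, symmetric]
    by (simp add: sum_distrib_left mult_ac)
  also have "\<dots> \<le> (\<Sum>w\<in>W. \<pi> $ w * (\<Sum>v\<in>UNIV. P $ w $ v * ?\<tau> $ u))"
    using bound pi(1) by (intro sum_mono mult_left_mono) (auto simp: probability_vector_def)
  \<comment> \<open>The factor \<open>?\<tau> $ u\<close> is constant and the rows of
    \<open>P\<close> sum to 1.\<close>
  also have "\<dots> = mass \<pi> W * ?\<tau> $ u"
    using P(1) by (simp add: stochastic_def mass_def flip: sum_distrib_right)
  finally show ?thesis .
qed

text \<open>If the mass were 0, \<open>\<pi>\<close> would vanish on \<open>W\<close> and Kac's
  identity would read 0 = 1.\<close>

lemma mass_pos:
  fixes P :: "real^'v^'v"
  assumes P: "stochastic P" "irreducible_matrix P" "W \<noteq> {}"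
    and pi: "probability_vector \<pi>" "\<pi> v* P = \<pi>"
  shows "mass \<pi> W > 0"
proof -
  have nonneg: "0 \<le> \<pi> $ w" for w using pi(1) by (simp add: probability_vector_def)
  have "mass \<pi> W \<noteq> 0"
  proof
    assume "mass \<pi> W = 0"
    then have "\<pi> $ w = 0" if "w \<in> W" for w
      using that nonneg by (simp add: mass_def sum_nonneg_eq_0_iff)
    then show False using kac_identity[OF P pi] \<open>mass \<pi> W = 0\<close> by simp
  qed
  moreover have "0 \<le> mass \<pi> W" using nonneg by (simp add: mass_def sum_nonneg)
  ultimately show ?thesis by simp
qed

theorem proposition4:
  fixes P :: "real^'v^'v" and \<pi> :: "real^'v"
  assumes "stochastic P" and "irreducible_matrix P"
    and "probability_vector \<pi>" and "\<pi> v* P = \<pi>"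
  shows "\<forall>W :: 'v set.
    min_entrance_time P W \<ge> ereal (path_conductance P W) * (1 / ereal (mass \<pi> W) - 1)"
proof
  fix W :: "'v set"
  show "min_entrance_time P W \<ge> ereal (path_conductance P W) * (1 / ereal (mass \<pi> W) - 1)"
  proof (cases "W = {} \<or> W = UNIV")
    case True
    then show ?thesis by (simp add: min_entrance_time_def)
  next
    case False
    then have W: "W \<noteq> {}" "UNIV - W \<noteq> {}" by auto
    let ?T = "(\<lambda>u. entrance_times P W $ u) ` (UNIV - W)"
    have "Min ?T \<in> ?T" using W(2) by (intro Min_in) auto
    then obtain u where u: "u \<notin> W" "Min ?T = entrance_times P W $ u" by auto
    have min: "entrance_times P W $ u \<le> entrance_times P W $ v" if "v \<notin> W" for v
      unfolding u(2)[symmetric] using that by (intro Min_le) auto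
    note pos = mass_pos[OF assms(1,2) W(1) assms(3,4)]
    have "path_conductance P W * (1 / mass \<pi> W - 1) \<le> entrance_times P W $ u"
      using entrance_times_minimizer_bound[OF assms(1,2) W(1) assms(3,4) u(1) min] pos
      by (simp add: field_simps)
    \<comment> \<open>Positive mass makes the extended division an ordinary real one.\<close>
    moreover have "ereal (path_conductance P W) * (1 / ereal (mass \<pi> W) - 1)
        = ereal (path_conductance P W * (1 / mass \<pi> W - 1))"
      using pos by (simp add: one_ereal_def)
    ultimately show ?thesis using False u(2) by (simp add: min_entrance_time_def)
  qed
qed

end
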